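(* Let $n \ge 1$, let $d \ge 2$ be even, and let $F \in \mathbb{R}(n,d)$ be a real homogeneous polynomial of degree $d$ in $n$ variables. If the characteristic polynomial of $F$ satisfies $\chi(F)(t) > 0$ for all $t \in \mathbb{R}_{\ge 0}$, then $F > 0$.
   Context: For a field $K$, $K(n,d)$ denotes the $K$-vector space of homogeneous polynomials of degree $d$ in $n$ variables $x_1,\dots,x_n$ with coefficients in $K$ (including $0$). For $F \in \mathbb{R}(n,d)$, $F > 0$ (positive) means $F(x)> 0$ for all $x\in\mathbb{R}^n\setminus\{0\}$. Let $\nabla(n,d,\mathbb{C}) = \{F \in \mathbb{C}(n,d) : \text{there is } x\in\mathbb{C}^n\setminus\{0\} \text{ with } \frac{\partial F}{\partial x_i}(x)=0 \text{ for all } i\}$ be the set of singular polynomials. It is known to be an irreducible algebraic hypersurface in $\mathbb{C}(n,d)$ of degree $D=n(d-1)^{n-1}$, defined over $\mathbb{Q}$. The discriminant $\Delta$ is the irreducible polynomial in the coefficients of $F$, homogeneous of degree $D$, with rational coefficients, such that $\nabla(n,d,\mathbb{C})=\{F\in\mathbb{C}(n,d) : \Delta(F)=0\}$, normalized by $\Delta(J)=1$, where $J(x)=\sum_{j=1}^n x_j^d$. The characteristic polynomial of $F$ is $\chi(F)(t)=\Delta(F+tJ)\in\mathbb{R}[t]$. *)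

theory Defs
  imports
    "HOL-Analysis.Analysis"
    "HOL-Computational_Algebra.Polynomial"
    "HOL-Library.Poly_Mapping"
begin

text \<open>
  Multivariate polynomials with variables indexed by \<open>'v\<close> and coefficients in \<open>'a\<close> are finitely
  supported maps from monomials to coefficients; \<open>HOL-Library.Poly_Mapping\<close> supplies the
  (convolution) ring structure.
\<close>

type_synonym 'v monomial = "'v \<Rightarrow>\<^sub>0 nat"
type_synonym ('v, 'a) mpol = "'v monomial \<Rightarrow>\<^sub>0 'a"

definition total_degree :: "'v monomial \<Rightarrow> nat" where
  "total_degree m = (\<Sum>v\<in>Poly_Mapping.keys m. Poly_Mapping.lookup m v)"

definition mpol_eval ::
  "('a::zero \<Rightarrow> 'b::comm_semiring_1) \<Rightarrow> ('v, 'a) mpol \<Rightarrow> ('v \<Rightarrow> 'b) \<Rightarrow> 'b" where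
  \<comment> \<open>value at \<open>x\<close> after mapping the coefficients into \<open>'b\<close> by \<open>\<phi>\<close>\<close>
  "mpol_eval \<phi> p x = (\<Sum>m\<in>Poly_Mapping.keys p. \<phi> (Poly_Mapping.lookup p m) * (\<Prod>v\<in>Poly_Mapping.keys m. x v ^ Poly_Mapping.lookup m v))"

definition mpol_deriv :: "'v \<Rightarrow> ('v, 'a::comm_semiring_1) mpol \<Rightarrow> ('v, 'a) mpol" where
  "mpol_deriv i p = (\<Sum>m\<in>Poly_Mapping.keys p.
     Poly_Mapping.single (m - Poly_Mapping.single i 1) (of_nat (Poly_Mapping.lookup m i) * Poly_Mapping.lookup p m))"

text \<open>Homogeneous polynomials of degree \<open>d\<close>, including \<open>0\<close>.\<close>

definition forms :: "nat \<Rightarrow> ('v, 'a::zero) mpol set" where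
  "forms d = {F. \<forall>m\<in>Poly_Mapping.keys F. total_degree m = d}"

definition positive_form :: "('n::finite, real) mpol \<Rightarrow> bool" where
  "positive_form F \<longleftrightarrow> (\<forall>x :: real ^ 'n. x \<noteq> 0 \<longrightarrow> mpol_eval (\<lambda>c. c) F (\<lambda>i. x $ i) > 0)"

definition singular_forms :: "nat \<Rightarrow> ('n::finite, complex) mpol set" where
  "singular_forms d = {F \<in> forms d. \<exists>x :: complex ^ 'n. x \<noteq> 0 \<and>
     (\<forall>i. mpol_eval (\<lambda>c. c) (mpol_deriv i F) (\<lambda>j. x $ j) = 0)}"

definition power_sum_form :: "nat \<Rightarrow> ('n::finite, 'a::comm_semiring_1) mpol" where
  "power_sum_form d = (\<Sum>j\<in>UNIV. Poly_Mapping.single (Poly_Mapping.single j d) 1)"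

text \<open>
  A polynomial \<open>\<Delta>\<close> in the coefficients of forms in \<open>n\<close> variables has one variable for each monomial
  in the variables \<open>'n\<close>; substituting the coefficients of \<open>F\<close> for these variables gives \<open>\<Delta>(F)\<close>.
  The rational coefficients of \<open>\<Delta>\<close> are mapped into the coefficient ring of \<open>F\<close> by \<open>\<phi>\<close>.
\<close>

definition at_form ::
  "(rat \<Rightarrow> 'a::comm_semiring_1) \<Rightarrow> ('n monomial, rat) mpol \<Rightarrow> ('n, 'a) mpol \<Rightarrow> 'a" where
  "at_form \<phi> \<Delta> F = mpol_eval \<phi> \<Delta> (Poly_Mapping.lookup F)"

text \<open>
  Only the variables belonging to monomials of degree \<open>d\<close> may occur in a discriminant.
  Irreducibility is over the complex numbers, as the singular forms are an irreducible hypersurface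
  in the complex space of forms.
\<close>

definition is_discriminant :: "nat \<Rightarrow> ('n::finite monomial, rat) mpol \<Rightarrow> bool" where
  "is_discriminant d \<Delta> \<longleftrightarrow>
     (\<forall>M\<in>Poly_Mapping.keys \<Delta>. \<forall>\<alpha>\<in>Poly_Mapping.keys M. total_degree \<alpha> = d) \<and>
     \<Delta> \<in> forms (CARD('n) * (d - 1) ^ (CARD('n) - 1)) \<and>
     irreducible (Poly_Mapping.map of_rat \<Delta> :: ('n monomial, complex) mpol) \<and>
     singular_forms d = {F \<in> forms d. at_form of_rat \<Delta> F = 0} \<and>
     at_form (\<lambda>c. c) \<Delta> (power_sum_form d) = 1"

text \<open>
  \<open>\<chi>(F) = \<Delta>(F + tJ)\<close>, where \<open>F + tJ\<close> is a form over the ring of real polynomials in \<open>t = [:0, 1:]\<close>.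
\<close>

definition form_char_poly ::
  "('n::finite monomial, rat) mpol \<Rightarrow> nat \<Rightarrow> ('n, real) mpol \<Rightarrow> real poly" where
  "form_char_poly \<Delta> d F = at_form (\<lambda>c. [:of_rat c:]) \<Delta>
     (Poly_Mapping.map (\<lambda>c. [:c:]) F + Poly_Mapping.single 0 [:0, 1:] * power_sum_form d)"

end

theory Submission
  imports Defs
begin

text \<open>
  The discriminant can only be nonzero along the whole ray \<open>F + tJ\<close>, \<open>t \<ge> 0\<close>, if \<open>F\<close> never
  has to cross the boundary of the cone of positive forms. Suppose \<open>F\<close> is not positive. As \<open>d\<close> is
  even, \<open>J\<close> is positive, so the continuous function \<open>F/J\<close> attains a minimum \<open>-s\<close> on the
  unit sphere, and \<open>s \<ge> 0\<close> because \<open>F\<close> takes a nonpositive value there. By homogeneity the form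
  \<open>G = F + sJ\<close> is nonnegative everywhere, and it vanishes at the minimizing point
  (\<open>nonpositive_form_on_boundary\<close>). A zero of a nonnegative function is a minimum, hence a critical
  point (\<open>gradient_zero_at_minimum\<close>); so \<open>G\<close>, regarded as a complex form, is singular. The
  discriminant therefore vanishes at \<open>G\<close>, and \<open>\<chi>(F)(s) = \<Delta>(G) = 0\<close> contradicts the
  assumption on \<open>\<chi>(F)\<close>.

  What remains is compatibility with coefficient extensions: evaluation at \<open>t\<close> carries the
  discriminant over real polynomials to the one over the reals (\<open>poly_form_char_poly\<close>), and the
  inclusion of the reals into the complex numbers commutes with derivatives and with \<open>\<Delta>\<close>.
\<close>

section \<open>Evaluation of polynomials\<close>

definition monom_eval :: "('v \<Rightarrow> 'b::comm_semiring_1) \<Rightarrow> 'v monomial \<Rightarrow> 'b" where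
  "monom_eval x m = (\<Prod>v\<in>Poly_Mapping.keys m. x v ^ Poly_Mapping.lookup m v)"

lemma monom_eval_UNIV:
  fixes m :: "'v::finite monomial"
  shows "monom_eval x m = (\<Prod>v\<in>UNIV. x v ^ Poly_Mapping.lookup m v)"
  unfolding monom_eval_def
  by (rule prod.mono_neutral_left) (auto simp: in_keys_iff)

lemma mpol_eval_superset:
  assumes "finite S" "Poly_Mapping.keys p \<subseteq> S" "\<phi> 0 = 0"
  shows "mpol_eval \<phi> p x = (\<Sum>m\<in>S. \<phi> (Poly_Mapping.lookup p m) * monom_eval x m)"
  unfolding mpol_eval_def monom_eval_def
  by (rule sum.mono_neutral_left) (use assms in \<open>auto simp: in_keys_iff\<close>)

lemma mpol_eval_add:
  fixes p q :: "('v, 'a::comm_semiring_1) mpol"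
  shows "mpol_eval (\<lambda>c. c) (p + q) x = mpol_eval (\<lambda>c. c) p x + mpol_eval (\<lambda>c. c) q x"
proof -
  let ?S = "Poly_Mapping.keys p \<union> Poly_Mapping.keys q"
  have "Poly_Mapping.keys (p + q) \<subseteq> ?S"
    by (rule Poly_Mapping.keys_add)
  then show ?thesis
    by (simp add: mpol_eval_superset[where S = ?S] lookup_add distrib_right sum.distrib)
qed

lemma mpol_eval_single:
  "mpol_eval (\<lambda>c. c) (Poly_Mapping.single m c) x = c * monom_eval x m"
  by (simp add: mpol_eval_superset[where S = "{m}"])

lemma mpol_eval_sum:
  fixes p :: "'i \<Rightarrow> ('v, 'a::comm_semiring_1) mpol"
  shows "mpol_eval (\<lambda>c. c) (\<Sum>i\<in>I. p i) x = (\<Sum>i\<in>I. mpol_eval (\<lambda>c. c) (p i) x)"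
  by (induction I rule: infinite_finite_induct) (auto simp: mpol_eval_add, simp_all add: mpol_eval_def)

lemma lookup_scale:
  "Poly_Mapping.lookup (Poly_Mapping.single 0 s * p) m = s * Poly_Mapping.lookup p m"
  by (simp flip: mult_map_scale_conv_mult add: map.rep_eq when_def)

lemma mpol_eval_scale:
  fixes p :: "('v, 'a::comm_semiring_1) mpol"
  shows "mpol_eval (\<lambda>c. c) (Poly_Mapping.single 0 s * p) x = s * mpol_eval (\<lambda>c. c) p x"
proof -
  have "Poly_Mapping.keys (Poly_Mapping.single 0 s * p) \<subseteq> Poly_Mapping.keys p"
    by (auto simp: in_keys_iff lookup_scale)
  then show ?thesis
    by (simp add: mpol_eval_superset[where S = "Poly_Mapping.keys p"] lookup_scale
        sum_distrib_left mult.assoc)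
qed

section \<open>Homogeneity and the power sum form\<close>

lemma monom_eval_homogeneous:
  "monom_eval (\<lambda>v. c * x v) m = c ^ total_degree m * monom_eval x m"
  by (simp add: monom_eval_def total_degree_def power_mult_distrib prod.distrib power_sum)

lemma mpol_eval_homogeneous:
  assumes "F \<in> forms d"
  shows "mpol_eval (\<lambda>c. c) F (\<lambda>v. c * x v) = c ^ d * mpol_eval (\<lambda>c. c) F x"
  using assms
  by (auto simp: mpol_eval_superset[where S = "Poly_Mapping.keys F"] monom_eval_homogeneous
      forms_def sum_distrib_left algebra_simps intro!: sum.cong)

lemma lookup_power_sum_form:
  "Poly_Mapping.lookup (power_sum_form d :: ('n::finite, 'a::comm_semiring_1) mpol) m =
     (\<Sum>j\<in>UNIV. 1 when Poly_Mapping.single j d = m)"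
  by (simp add: power_sum_form_def lookup_sum lookup_single)

lemma total_degree_single: "total_degree (Poly_Mapping.single j d) = d"
  by (simp add: total_degree_def)

lemma mpol_eval_power_sum_form:
  fixes x :: "'n::finite \<Rightarrow> 'a::comm_semiring_1"
  shows "mpol_eval (\<lambda>c. c) (power_sum_form d) x = (\<Sum>j\<in>UNIV. x j ^ d)"
  by (simp add: power_sum_form_def mpol_eval_sum mpol_eval_single monom_eval_def)
    (cases "d = 0"; simp)

lemma add_scaled_power_sum_in_forms:
  fixes F :: "('n::finite, 'a::comm_semiring_1) mpol"
  assumes "F \<in> forms d"
  shows "F + Poly_Mapping.single 0 s * power_sum_form d \<in> forms d"
proof -
  have "total_degree m = d"
    if "m \<in> Poly_Mapping.keys (F + Poly_Mapping.single 0 s * power_sum_form d)" for m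
  proof (cases "m \<in> Poly_Mapping.keys F")
    case True
    then show ?thesis using assms by (auto simp: forms_def)
  next
    case False
    then have "(\<Sum>j\<in>UNIV. 1 when Poly_Mapping.single j d = m) \<noteq> (0::'a)"
      using that by (auto simp: in_keys_iff lookup_add lookup_scale lookup_power_sum_form)
    then obtain j where "Poly_Mapping.single j d = m"
      by (auto simp: when_def split: if_splits elim!: sum.not_neutral_contains_not_neutral)
    then show ?thesis by (auto simp: total_degree_single)
  qed
  then show ?thesis by (auto simp: forms_def)
qed

lemma power_sum_form_positive:
  assumes "even d"
  shows "positive_form (power_sum_form d :: ('n::finite, real) mpol)"
  unfolding positive_form_def mpol_eval_power_sum_form
proof (intro allI impI)
  fix x :: "real ^ 'n" assume "x \<noteq> 0"
  then obtain i where "x $ i \<noteq> 0" by (auto simp: vec_eq_iff)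
  then have "x $ i ^ d > 0" using assms by (simp add: zero_less_power_eq)
  then show "(\<Sum>j\<in>UNIV. x $ j ^ d) > 0"
    using assms by (intro sum_pos2[of _ i]) (auto simp: zero_le_even_power)
qed

section \<open>Derivatives\<close>

lemma mpol_eval_deriv:
  fixes p :: "('v, 'a::comm_semiring_1) mpol"
  shows "mpol_eval (\<lambda>c. c) (mpol_deriv i p) x =
    (\<Sum>m\<in>Poly_Mapping.keys p. of_nat (Poly_Mapping.lookup m i) * Poly_Mapping.lookup p m *
       monom_eval x (m - Poly_Mapping.single i 1))"
  by (simp add: mpol_deriv_def mpol_eval_sum mpol_eval_single)

text \<open>
  If the variable \<open>i\<close> does not occur in \<open>m\<close>, the truncated difference leaves \<open>m\<close> unchanged,
  but then the factor in front of it is \<open>0\<close>.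
\<close>

lemma monom_eval_has_deriv:
  fixes x :: "'n::finite \<Rightarrow> real"
  shows "((\<lambda>t. monom_eval (x(i := t)) m) has_real_derivative
    of_nat (Poly_Mapping.lookup m i) * monom_eval x (m - Poly_Mapping.single i 1)) (at (x i))"
proof -
  let ?c = "\<Prod>v\<in>UNIV - {i}. x v ^ Poly_Mapping.lookup m v"
  have split_off: "monom_eval y m' = y i ^ Poly_Mapping.lookup m' i *
      (\<Prod>v\<in>UNIV - {i}. y v ^ Poly_Mapping.lookup m' v)" for y :: "'n \<Rightarrow> real" and m'
    by (simp add: monom_eval_UNIV prod.remove[of UNIV i])
  have lhs: "(\<lambda>t. monom_eval (x(i := t)) m) = (\<lambda>t. t ^ Poly_Mapping.lookup m i * ?c)"
    by (simp add: split_off)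
  have rhs: "monom_eval x (m - Poly_Mapping.single i 1) = x i ^ (Poly_Mapping.lookup m i - 1) * ?c"
    by (simp add: split_off lookup_minus lookup_single when_def)
  show ?thesis unfolding lhs rhs
    by (auto intro!: derivative_eq_intros)
qed

lemma mpol_eval_has_deriv:
  fixes p :: "('n::finite, real) mpol"
  shows "((\<lambda>t. mpol_eval (\<lambda>c. c) p (x(i := t))) has_real_derivative
    mpol_eval (\<lambda>c. c) (mpol_deriv i p) x) (at (x i))"
proof -
  have "((\<lambda>t. \<Sum>m\<in>Poly_Mapping.keys p. Poly_Mapping.lookup p m * monom_eval (x(i := t)) m)
      has_real_derivative (\<Sum>m\<in>Poly_Mapping.keys p. Poly_Mapping.lookup p m *
        (of_nat (Poly_Mapping.lookup m i) * monom_eval x (m - Poly_Mapping.single i 1)))) (at (x i))"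
    by (intro DERIV_sum DERIV_cmult monom_eval_has_deriv)
  then show ?thesis
    by (simp add: mpol_eval_deriv mpol_eval_superset[where S = "Poly_Mapping.keys p"] mult_ac)
qed

lemma gradient_zero_at_minimum:
  fixes p :: "('n::finite, real) mpol"
  assumes "\<And>y. mpol_eval (\<lambda>c. c) p x \<le> mpol_eval (\<lambda>c. c) p y"
  shows "mpol_eval (\<lambda>c. c) (mpol_deriv i p) x = 0"
  by (rule DERIV_local_min[OF mpol_eval_has_deriv, where d = 1]) (auto intro: assms)

section \<open>Change of coefficients\<close>

lemma keys_map_of_real:
  "Poly_Mapping.keys (Poly_Mapping.map complex_of_real p) = Poly_Mapping.keys p"
  by (auto simp: in_keys_iff map.rep_eq when_def)

lemma lookup_map_of_real:
  "Poly_Mapping.lookup (Poly_Mapping.map complex_of_real p) m = of_real (Poly_Mapping.lookup p m)"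
  by (simp add: map.rep_eq when_def)

lemma monom_eval_of_real:
  "monom_eval (\<lambda>v. complex_of_real (x v)) m = of_real (monom_eval x m)"
  by (simp add: monom_eval_def)

lemma mpol_eval_deriv_of_real:
  "mpol_eval (\<lambda>c. c) (mpol_deriv i (Poly_Mapping.map complex_of_real p)) (\<lambda>v. of_real (x v)) =
     of_real (mpol_eval (\<lambda>c. c) (mpol_deriv i p) x)"
  by (simp add: mpol_eval_deriv keys_map_of_real lookup_map_of_real monom_eval_of_real)

lemma at_form_of_real:
  "at_form of_rat \<Delta> (Poly_Mapping.map complex_of_real p) = of_real (at_form of_rat \<Delta> p)"
proof -
  have "complex_of_real (of_rat q) = of_rat q" for q
    by (cases q) (simp add: of_rat_rat)
  then show ?thesis
    by (simp add: at_form_def mpol_eval_def lookup_map_of_real)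
qed

lemma poly_form_char_poly:
  "poly (form_char_poly \<Delta> d F) t =
     at_form of_rat \<Delta> (F + Poly_Mapping.single 0 t * power_sum_form d)"
proof -
  have "poly (Poly_Mapping.lookup (Poly_Mapping.map (\<lambda>c. [:c:]) F +
          Poly_Mapping.single 0 [:0, 1:] * power_sum_form d) m) t =
        Poly_Mapping.lookup (F + Poly_Mapping.single 0 t * power_sum_form d) m" for m
  proof -
    have "poly (\<Sum>j\<in>UNIV. 1 when Poly_Mapping.single j d = m) t =
        (\<Sum>j\<in>UNIV. 1 when Poly_Mapping.single j d = m)"
      unfolding poly_sum by (intro sum.cong) (auto simp: when_def)
    then show ?thesis
      by (simp add: lookup_add lookup_scale lookup_power_sum_form map.rep_eq when_def)
  qed
  then show ?thesis
    by (simp add: form_char_poly_def at_form_def mpol_eval_def poly_sum poly_prod)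
qed

section \<open>Nonpositive forms and the boundary of the positive cone\<close>

lemma continuous_on_mpol_eval:
  fixes p :: "('n::finite, real) mpol"
  shows "continuous_on S (\<lambda>x :: real ^ 'n. mpol_eval (\<lambda>c. c) p (\<lambda>i. x $ i))"
  unfolding mpol_eval_def by (intro continuous_intros)

text \<open>
  The parameter \<open>s\<close> is \<open>-min F/J\<close> over the unit sphere: the last time at which the ray \<open>F + tJ\<close>
  is not inside the cone of positive forms.
\<close>

lemma nonpositive_form_on_boundary:
  fixes F :: "('n::finite, real) mpol"
  assumes "d > 0" "even d" "F \<in> forms d" "\<not> positive_form F"
  obtains s and x :: "real ^ 'n" where "s \<ge> 0" "x \<noteq> 0"
    "mpol_eval (\<lambda>c. c) (F + Poly_Mapping.single 0 s * power_sum_form d) (\<lambda>i. x $ i) = 0"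
    "\<And>y. mpol_eval (\<lambda>c. c) (F + Poly_Mapping.single 0 s * power_sum_form d) y \<ge> 0"
proof -
  define f where "f = (\<lambda>x :: real ^ 'n. mpol_eval (\<lambda>c. c) F (\<lambda>i. x $ i))"
  define j where "j = (\<lambda>x :: real ^ 'n. mpol_eval (\<lambda>c. c) (power_sum_form d) (\<lambda>i. x $ i))"
  have j_pos: "j x > 0" if "x \<noteq> 0" for x
    using power_sum_form_positive[OF \<open>even d\<close>] that by (auto simp: positive_form_def j_def)
  have f_scale: "f (c *\<^sub>R x) = c ^ d * f x" for c x
    using mpol_eval_homogeneous[OF \<open>F \<in> forms d\<close>, of c "\<lambda>i. x $ i"]
    unfolding f_def vector_scaleR_component real_scaleR_def .
  have j_scale: "j (c *\<^sub>R x) = c ^ d * j x" for c x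
    by (simp add: j_def mpol_eval_power_sum_form power_mult_distrib sum_distrib_left)
  obtain x0 where x0: "x0 \<noteq> 0" "f x0 \<le> 0"
    using assms(4) by (auto simp: positive_form_def f_def not_less)
  let ?S = "sphere (0 :: real ^ 'n) 1"
  have to_sphere: "inverse (norm y) *\<^sub>R y \<in> ?S" if "y \<noteq> 0" for y :: "real ^ 'n"
    using that by simp
  have "continuous_on ?S (\<lambda>x. f x / j x)"
  proof (rule continuous_on_divide)
    show "\<forall>x\<in>?S. j x \<noteq> 0"
    proof
      fix x :: "real ^ 'n" assume "x \<in> ?S"
      then have "x \<noteq> 0" by auto
      then show "j x \<noteq> 0" using j_pos[of x] by simp
    qed
  qed (auto simp: f_def j_def intro: continuous_on_mpol_eval)
  moreover have "?S \<noteq> {}" using to_sphere[OF x0(1)] by blast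
  ultimately have "\<exists>x\<in>?S. \<forall>y\<in>?S. f x / j x \<le> f y / j y"
    by (intro continuous_attains_inf compact_sphere)
  then obtain x1 where x1: "x1 \<in> ?S" "\<And>y. y \<in> ?S \<Longrightarrow> f x1 / j x1 \<le> f y / j y"
    by blast
  have "x1 \<noteq> 0" using x1(1) by auto
  define s where "s = - (f x1 / j x1)"
  have quot: "f x1 / j x1 \<le> f y / j y" if "y \<noteq> 0" for y
    using x1(2)[OF to_sphere[OF that]] that by (simp add: f_scale j_scale)
  have eval: "mpol_eval (\<lambda>c. c) (F + Poly_Mapping.single 0 s * power_sum_form d) (\<lambda>i. y $ i)
      = f y + s * j y" for y
    by (simp add: f_def j_def mpol_eval_add mpol_eval_scale)
  have nonneg: "f y + s * j y \<ge> 0" for y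
  proof (cases "y = 0")
    case True
    then show ?thesis
      using f_scale[of 0 y] j_scale[of 0 y] \<open>d > 0\<close> True by (simp add: zero_power)
  next
    case False
    then have "f x1 / j x1 * j y \<le> f y"
      using quot[OF False] j_pos[OF False] by (simp only: pos_le_divide_eq)
    then show ?thesis by (simp add: s_def)
  qed
  show thesis
  proof
    show "s \<ge> 0"
      using quot[OF x0(1)] divide_nonpos_pos[OF x0(2) j_pos[OF x0(1)]] by (simp only: s_def)
    show "x1 \<noteq> 0" by fact
    show "mpol_eval (\<lambda>c. c) (F + Poly_Mapping.single 0 s * power_sum_form d) (\<lambda>i. x1 $ i) = 0"
      unfolding eval using j_pos[OF \<open>x1 \<noteq> 0\<close>] by (simp add: s_def)
    show "mpol_eval (\<lambda>c. c) (F + Poly_Mapping.single 0 s * power_sum_form d) y \<ge> 0" for y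
      using eval[of "\<chi> i. y i"] nonneg by simp
  qed
qed

section \<open>Positivity from the characteristic polynomial\<close>

theorem mainTheorem2:
  fixes d :: nat
    and F :: "('n::finite, real) mpol"
    and \<Delta> :: "('n monomial, rat) mpol"
  assumes "d \<ge> 2" and "even d"
    and "F \<in> forms d"
    and "is_discriminant d \<Delta>"
    and "\<forall>t::real. t \<ge> 0 \<longrightarrow> poly (form_char_poly \<Delta> d F) t > 0"
  shows "positive_form F"
proof (rule ccontr)
  assume "\<not> positive_form F"
  have "d > 0" using \<open>d \<ge> 2\<close> by simp
  obtain s and x :: "real ^ 'n" where s: "s \<ge> 0" and x: "x \<noteq> 0"
    and zero: "mpol_eval (\<lambda>c. c) (F + Poly_Mapping.single 0 s * power_sum_form d) (\<lambda>i. x $ i) = 0"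
    and nonneg: "\<And>y. mpol_eval (\<lambda>c. c) (F + Poly_Mapping.single 0 s * power_sum_form d) y \<ge> 0"
    using nonpositive_form_on_boundary
      [OF \<open>d > 0\<close> \<open>even d\<close> \<open>F \<in> forms d\<close> \<open>\<not> positive_form F\<close>] by blast
  define G where "G = F + Poly_Mapping.single 0 s * power_sum_form d"
  let ?G = "Poly_Mapping.map complex_of_real G"
  let ?x = "(\<chi> i. complex_of_real (x $ i)) :: complex ^ 'n"
  have grad: "mpol_eval (\<lambda>c. c) (mpol_deriv i G) (\<lambda>i. x $ i) = 0" for i
    by (rule gradient_zero_at_minimum) (use zero nonneg in \<open>simp add: G_def\<close>)
  have "G \<in> forms d"
    unfolding G_def by (rule add_scaled_power_sum_in_forms[OF \<open>F \<in> forms d\<close>])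
  then have "?G \<in> forms d"
    by (simp add: forms_def keys_map_of_real)
  moreover have "?x \<noteq> 0"
    using x by (auto simp: vec_eq_iff)
  moreover have "mpol_eval (\<lambda>c. c) (mpol_deriv i ?G) (\<lambda>j. ?x $ j) = 0" for i
    unfolding vec_lambda_beta mpol_eval_deriv_of_real grad by simp
  ultimately have "?G \<in> singular_forms d"
    unfolding singular_forms_def by blast
  then have "at_form of_rat \<Delta> ?G = 0"
    using \<open>is_discriminant d \<Delta>\<close> by (auto simp: is_discriminant_def)
  then have "poly (form_char_poly \<Delta> d F) s = 0"
    by (simp add: at_form_of_real poly_form_char_poly G_def)
  then show False
    using assms(5) s by fastforce
qed

end
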